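(* Let $\alpha$ be a partial action of a group $G$ on a set $X$, with subsets $S_g\subseteq X$ and bijections $\alpha_g:S_{g^{-1}}\to S_g$, $g\in G$. For $a,b\in X$ write $a\sim b$ if there exists $g\in G$ such that $a\in S_{g^{-1}}$ and $b=\alpha_g(a)$. Then $\sim$ is an equivalence relation on $X$.
   Context: A partial action $\alpha$ of a group $G$ (with identity $1$) on a set $X$ is a collection of subsets $S_g$, $g\in G$, of $X$ and bijections $\alpha_g:S_{g^{-1}}\to S_g$ such that: (i) $S_1=X$ and $\alpha_1$ is the identity map of $X$; (ii) $S_{(gh)^{-1}}\supseteq\alpha_h^{-1}(S_h\cap S_{g^{-1}})$ for all $g,h\in G$; (iii) $\alpha_g\circ\alpha_h(x)=\alpha_{gh}(x)$ for all $x\in\alpha_h^{-1}(S_h\cap S_{g^{-1}})$. *)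

theory Defs
  imports "HOL-Algebra.Group"
begin

text \<open>
  The maps are represented by total functions \<open>\<alpha> g\<close>, of which only the restriction to
  \<open>S (inv g)\<close> is meaningful; hence the preimage under the bijection
  \<open>\<alpha> h : S (inv h) \<rightarrow> S h\<close> is the preimage under \<open>\<alpha> h\<close> cut down to \<open>S (inv h)\<close>.
\<close>

locale partial_action = group G
  for G :: "('g, 'm) monoid_scheme" (structure)
    and X :: "'x set"
    and S :: "'g \<Rightarrow> 'x set"
    and \<alpha> :: "'g \<Rightarrow> 'x \<Rightarrow> 'x" +
  assumes dom_subset: "g \<in> carrier G \<Longrightarrow> S g \<subseteq> X"
    and bij: "g \<in> carrier G \<Longrightarrow> bij_betw (\<alpha> g) (S (inv g)) (S g)"
    and dom_one: "S \<one> = X"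
    and act_one: "x \<in> X \<Longrightarrow> \<alpha> \<one> x = x"
    and dom_mult: "\<lbrakk>g \<in> carrier G; h \<in> carrier G\<rbrakk> \<Longrightarrow>
      \<alpha> h -` (S h \<inter> S (inv g)) \<inter> S (inv h) \<subseteq> S (inv (g \<otimes> h))"
    and act_mult: "\<lbrakk>g \<in> carrier G; h \<in> carrier G;
      x \<in> \<alpha> h -` (S h \<inter> S (inv g)) \<inter> S (inv h)\<rbrakk> \<Longrightarrow>
      \<alpha> g (\<alpha> h x) = \<alpha> (g \<otimes> h) x"

definition partial_orbit_rel ::
  "('g, 'm) monoid_scheme \<Rightarrow> 'x set \<Rightarrow> ('g \<Rightarrow> 'x set) \<Rightarrow> ('g \<Rightarrow> 'x \<Rightarrow> 'x) \<Rightarrow> 'x rel"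
  where "partial_orbit_rel G X S \<alpha> =
    {(a, b) \<in> X \<times> X. \<exists>g \<in> carrier G. a \<in> S (inv\<^bsub>G\<^esub> g) \<and> b = \<alpha> g a}"

end

theory Submission
  imports Defs
begin

text \<open>Reflexivity, symmetry and transitivity come from the identity, inverses and products of
  the group. The key is \<open>act_comp\<close>: if \<open>\<alpha> g (\<alpha> h a)\<close> is
  defined, then so is \<open>\<alpha> (g \<otimes> h) a\<close>, with the same value. Chaining two
  moves is thus a single move, and \<open>inv g\<close> undoes \<open>g\<close>.\<close>

context partial_action
begin

lemma act_mem:
  assumes "g \<in> carrier G" "a \<in> S (inv g)"
  shows "\<alpha> g a \<in> S g"
  using bij[OF assms(1)] assms(2) by (auto simp: bij_betw_def)

text \<open>Pointwise form of axioms (ii) and (iii): the preimage there also demands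
  \<open>\<alpha> h a \<in> S h\<close>, which is automatic by \<open>act_mem\<close>.\<close>

lemma act_comp:
  assumes "g \<in> carrier G" "h \<in> carrier G" "a \<in> S (inv h)" "\<alpha> h a \<in> S (inv g)"
  shows "a \<in> S (inv (g \<otimes> h))" "\<alpha> g (\<alpha> h a) = \<alpha> (g \<otimes> h) a"
proof -
  have a: "a \<in> \<alpha> h -` (S h \<inter> S (inv g)) \<inter> S (inv h)"
    using assms act_mem by simp
  show "a \<in> S (inv (g \<otimes> h))" using dom_mult[OF assms(1,2)] a by blast
  show "\<alpha> g (\<alpha> h a) = \<alpha> (g \<otimes> h) a" using act_mult[OF assms(1,2) a] .
qed

text \<open>Apply \<open>act_comp\<close> to \<open>inv g\<close> and \<open>g\<close>: since
  \<open>inv (inv g) = g\<close>, the point \<open>\<alpha> g a\<close> lies in the domain of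
  \<open>\<alpha> (inv g)\<close>, and the product \<open>\<one>\<close> fixes
  \<open>a\<close>.\<close>

lemma act_inv_act:
  assumes "g \<in> carrier G" "a \<in> S (inv g)"
  shows "\<alpha> (inv g) (\<alpha> g a) = a"
proof -
  have "a \<in> X" using assms dom_subset[of "inv g"] by auto
  then show ?thesis
    using act_comp(2)[of "inv g" g a] act_mem[OF assms] assms act_one by simp
qed

lemma equiv_partial_orbit_rel: "equiv X (partial_orbit_rel G X S \<alpha>)"
proof (rule equivI)
  show "partial_orbit_rel G X S \<alpha> \<subseteq> X \<times> X"
    by (auto simp: partial_orbit_rel_def)
  show "refl_on X (partial_orbit_rel G X S \<alpha>)"
    using dom_one act_one
    by (auto simp: refl_on_def partial_orbit_rel_def intro!: bexI[of _ \<one>])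
  show "sym (partial_orbit_rel G X S \<alpha>)"
  proof (rule symI)
    fix a b assume "(a, b) \<in> partial_orbit_rel G X S \<alpha>"
    then obtain g where "a \<in> X" "b \<in> X" "g \<in> carrier G" "a \<in> S (inv g)" "b = \<alpha> g a"
      by (auto simp: partial_orbit_rel_def)
    \<comment> \<open>The witness \<open>inv g\<close> needs \<open>b \<in> S (inv (inv g))\<close>,
      that is \<open>b \<in> S g\<close>.\<close>
    then show "(b, a) \<in> partial_orbit_rel G X S \<alpha>"
      using act_mem act_inv_act
      by (auto simp: partial_orbit_rel_def intro!: bexI[of _ "inv g"])
  qed
  show "trans (partial_orbit_rel G X S \<alpha>)"
  proof (rule transI)
    fix a b c
    assume "(a, b) \<in> partial_orbit_rel G X S \<alpha>" "(b, c) \<in> partial_orbit_rel G X S \<alpha>"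
    then obtain g h where "a \<in> X" "c \<in> X" "g \<in> carrier G" "h \<in> carrier G"
      "a \<in> S (inv g)" "b = \<alpha> g a" "b \<in> S (inv h)" "c = \<alpha> h b"
      by (auto simp: partial_orbit_rel_def)
    \<comment> \<open>Here \<open>g\<close> acts first, so the witness is
      \<open>h \<otimes> g\<close>, in this order.\<close>
    then show "(a, c) \<in> partial_orbit_rel G X S \<alpha>"
      using act_comp[of h g a]
      by (auto simp: partial_orbit_rel_def intro!: bexI[of _ "h \<otimes> g"])
  qed
qed

end

theorem lemma2p3:
  fixes G :: "('g, 'm) monoid_scheme"
    and X :: "'x set"
    and S :: "'g \<Rightarrow> 'x set"
    and \<alpha> :: "'g \<Rightarrow> 'x \<Rightarrow> 'x"
  assumes "partial_action G X S \<alpha>"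
  shows "equiv X (partial_orbit_rel G X S \<alpha>)"
  using assms by (rule partial_action.equiv_partial_orbit_rel)

end
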